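(* Let $N$ be an odd prime, let $k$ be a positive integer, and let $q(t)\in\mathbb{Z}[t]$ be a polynomial of the form $$q(t)=\sum_{i=0}^k\alpha_i t^{iN},$$ where $\alpha_0=1$ and all the coefficients $\alpha_i$ are positive integers. Set $$p(t):=q(t)-t^{kN+1}q(1/t)\in\mathbb{Z}[t].$$ Suppose that there are a positive integer $m$ and integers $n_1,\dots,n_m\geq 0$ with $n_m>0$ such that (1) $p(t)=\prod_{i=1}^m(1-t^i)^{n_i}$, and (2) $\sum_{i=1}^m n_i>\frac{21}{11}k+1$. Then $N=3$, $k=1$, $p(t)=(1-t)^2(1-t^2)$ and $q(t)=1+2t^3$. *)

theory Defs
  imports Complex_Main "HOL-Computational_Algebra.Computational_Algebra"
begin

text \<open>
  \<open>laurent_reverse d q\<close> is the polynomial \<open>t ^ d * q (1 / t)\<close>. It is a polynomial only if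
  \<open>degree q \<le> d\<close>; for smaller \<open>d\<close> the truncated subtraction gives it no meaning.
\<close>

definition laurent_reverse :: "nat \<Rightarrow> 'a::comm_semiring_1 poly \<Rightarrow> 'a poly" where
  "laurent_reverse d q = (\<Sum>i\<le>degree q. monom (coeff q i) (d - i))"

lemma poly_laurent_reverse:
  fixes x :: "'a::field"
  assumes "degree q \<le> d" and "x \<noteq> 0"
  shows "poly (laurent_reverse d q) x = x ^ d * poly q (1 / x)"
proof -
  have "poly (laurent_reverse d q) x = (\<Sum>i\<le>degree q. coeff q i * x ^ (d - i))"
    by (simp add: laurent_reverse_def poly_sum poly_monom)
  also have "\<dots> = (\<Sum>i\<le>degree q. x ^ d * (coeff q i * (1 / x) ^ i))"
    using assms by (intro sum.cong) (auto simp: power_diff power_one_over divide_simps)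
  finally show ?thesis
    by (simp add: poly_altdef sum_distrib_left)
qed

lemma map_poly_laurent_reverse:
  fixes q :: "int poly"
  shows "map_poly (of_int :: int \<Rightarrow> real) (laurent_reverse d q)
       = laurent_reverse d (map_poly of_int q)"
proof -
  have "coeff (map_poly (of_int :: int \<Rightarrow> real) (laurent_reverse d q)) j
      = coeff (laurent_reverse d (map_poly of_int q)) j" for j
  proof -
    have "degree (map_poly (of_int :: int \<Rightarrow> real) q) = degree q"
      by (rule degree_map_poly) simp
    then show ?thesis
      by (auto simp: laurent_reverse_def coeff_sum coeff_map_poly intro!: sum.cong)
  qed
  then show ?thesis by (rule poly_eqI)
qed

end

theory Submission
  imports Defs
begin

text \<open>
  Write \<open>D = (\<Sum>i\<le>m. i * n\<^sub>i)\<close> and \<open>M = (\<Sum>i\<le>m. n\<^sub>i)\<close>. The shape of \<open>p\<close> determines \<open>D\<close>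
  and, up to the parameter \<open>n\<^sub>1\<close>, all \<open>n\<^sub>i\<close> with \<open>i < N\<close>; these alone keep \<open>M\<close> small.

  In \<open>p\<close> the exponents divisible by \<open>N\<close> come from \<open>q\<close>, those congruent to \<open>1\<close> from its reversal,
  and no others occur. Hence \<open>p\<close> has degree \<open>D = k * N + 1\<close>, and with \<open>a = \<alpha>\<^sub>k\<close> it is congruent
  to \<open>1 - a * t\<close> modulo \<open>t ^ N\<close>. The logarithmic derivative of the product is
  \<open>t * p' / p = - (\<Sum>j\<ge>1. (\<Sum>d | d dvd j. d * n\<^sub>d) * t ^ j)\<close>, while that of \<open>1 - a * t\<close> is
  \<open>- (\<Sum>j\<ge>1. a ^ j * t ^ j)\<close>. Comparison gives \<open>(\<Sum>d | d dvd j. d * n\<^sub>d) = a ^ j\<close> for \<open>1 \<le> j < N\<close>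
  (lemma \<open>divisor_weight_eq_power\<close>); so \<open>n\<^sub>j\<close> is the number of Lyndon words of length \<open>j\<close> over
  \<open>a\<close> letters.

  Such exponents grow geometrically when \<open>a \<ge> 2\<close>, so most of the degree \<open>D\<close> sits at indices
  close to \<open>N\<close> or above, and \<open>M\<close> is then close to \<open>D / N\<close>. Precisely, with \<open>L = N - 1\<close> one
  has \<open>L * M \<le> D + (\<Sum>i<L. (L - i) * n\<^sub>i)\<close> by \<open>exponent_sum_le\<close>, and \<open>a ^ L \<le> D\<close> because the
  divisor sum at \<open>L\<close> is a part of \<open>D\<close>. If \<open>a = 1\<close>, the correction is just \<open>L - 1\<close>. If \<open>a \<ge> 2\<close>
  and \<open>L \<ge> 6\<close>, it is at most \<open>101 / 160 * a ^ L\<close> (lemma \<open>weighted_exponent_sum_le\<close>). Both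
  contradict \<open>M > 21 / 11 * k + 1\<close>. For \<open>N = 3\<close> and \<open>N = 5\<close> the correction is computed exactly; it leaves only \<open>N = 3\<close>, \<open>k = 1\<close>,
  \<open>a = 2\<close>, where \<open>q = 1 + a * t ^ N\<close> and hence \<open>p\<close> are known.
\<close>

section \<open>Divisor sums of the exponents\<close>

definition divisor_weight :: "(nat \<Rightarrow> nat) \<Rightarrow> nat \<Rightarrow> nat" where
  "divisor_weight e j = (\<Sum>d | d dvd j. d * e d)"

lemma geometric_fps:
  fixes i :: nat
  assumes "i > 0"
  shows "(1 - fps_X ^ i) * Abs_fps (\<lambda>j. if 0 < j \<and> i dvd j then 1 else 0) = (fps_X ^ i :: 'a::comm_ring_1 fps)"
proof (rule fps_ext)
  fix j
  have "i dvd j - i \<longleftrightarrow> i dvd j" if "i \<le> j"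
    using that by (simp add: dvd_minus_self)
  moreover have "\<not> i dvd j" if "0 < j" "j < i"
    using that by (auto dest: dvd_imp_le)
  ultimately show "((1 - fps_X ^ i) * Abs_fps (\<lambda>j. if 0 < j \<and> i dvd j then 1 else 0)) $ j = (fps_X ^ i :: 'a fps) $ j"
    using assms by (auto simp: left_diff_distrib fps_X_power_mult_nth fps_X_power_nth)
qed

lemma log_derivative_factor:
  fixes i c :: nat
  assumes "i > 0"
  shows "fps_X * fps_deriv ((1 - fps_X ^ i :: 'a::comm_ring_1 fps) ^ c) =
    - ((1 - fps_X ^ i) ^ c * (of_nat (i * c) * Abs_fps (\<lambda>j. if 0 < j \<and> i dvd j then 1 else 0)))"
proof (induction c)
  case (Suc c)
  let ?F = "1 - fps_X ^ i :: 'a fps"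
  let ?E = "Abs_fps (\<lambda>j. if 0 < j \<and> i dvd j then 1 else 0) :: 'a fps"
  have "fps_X * fps_deriv ?F = - (of_nat i * fps_X ^ i)"
  proof (rule fps_ext)
    fix j
    show "(fps_X * fps_deriv ?F) $ j = (- (of_nat i * fps_X ^ i)) $ j"
      using assms by (cases j) (auto simp: fps_X_power_nth simp flip: fps_of_nat)
  qed
  also have "\<dots> = - (of_nat i * (?F * ?E))"
    using geometric_fps[OF assms, where ?'a = 'a] by simp
  finally have E: "fps_X * fps_deriv ?F = - (of_nat i * (?F * ?E))" .
  have "fps_X * fps_deriv (?F ^ Suc c) = (fps_X * fps_deriv ?F) * ?F ^ c + ?F * (fps_X * fps_deriv (?F ^ c))"
    by (simp add: algebra_simps)
  also have "\<dots> = - (?F ^ Suc c * (of_nat (i * Suc c) * ?E))"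
    unfolding E Suc by (simp add: algebra_simps)
  finally show ?case .
qed simp

text \<open>
  Expanding each summand \<open>- i * e i * t ^ i / (1 - t ^ i)\<close> of the logarithmic derivative as a
  geometric series, the coefficient of \<open>t ^ j\<close> collects \<open>i * e i\<close> over the divisors \<open>i\<close> of \<open>j\<close>.
  The identity is multiplied by \<open>F\<close> so that it can be stated over the integers.
\<close>

lemma log_derivative_prod:
  fixes e :: "nat \<Rightarrow> nat"
  assumes "\<And>i. i > m \<Longrightarrow> e i = 0"
  defines "F \<equiv> (\<Prod>i=1..m. (1 - fps_X ^ i) ^ e i :: int fps)"
  shows "fps_X * fps_deriv F = - (F * Abs_fps (\<lambda>j. if j = 0 then 0 else int (divisor_weight e j)))"
proof -
  have supp': "i \<le> m" if "e i > 0" for i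
    using assms(1)[of i] that by (cases "m < i") auto
  let ?E = "\<lambda>i. Abs_fps (\<lambda>j. if 0 < j \<and> i dvd j then 1 else 0) :: int fps"
  have "fps_X * fps_deriv (\<Prod>i\<in>A. (1 - fps_X ^ i) ^ e i :: int fps) =
     - ((\<Prod>i\<in>A. (1 - fps_X ^ i) ^ e i) * (\<Sum>i\<in>A. of_nat (i * e i) * ?E i))"
    if "finite A" "0 \<notin> A" for A
    using that
  proof (induction A rule: finite_induct)
    case (insert i A)
    let ?u = "(1 - fps_X ^ i) ^ e i :: int fps"
    let ?P = "\<Prod>i\<in>A. (1 - fps_X ^ i) ^ e i :: int fps"
    let ?S = "\<Sum>i\<in>A. of_nat (i * e i) * ?E i"
    have IH: "fps_X * fps_deriv ?P = - (?P * ?S)" using insert by auto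
    have u: "fps_X * fps_deriv ?u = - (?u * (of_nat (i * e i) * ?E i))"
      using insert.prems by (intro log_derivative_factor) auto
    have "fps_X * fps_deriv (?u * ?P) = (fps_X * fps_deriv ?u) * ?P + ?u * (fps_X * fps_deriv ?P)"
      by (simp add: algebra_simps)
    also have "\<dots> = - (?u * ?P * (of_nat (i * e i) * ?E i + ?S))"
      unfolding IH u by (simp add: algebra_simps del: of_nat_mult)
    finally show ?case using insert by simp
  qed simp
  moreover have "(\<Sum>i=1..m. of_nat (i * e i) * ?E i) = Abs_fps (\<lambda>j. if j = 0 then 0 else int (divisor_weight e j))"
  proof (rule fps_ext)
    fix j
    have "(\<Sum>i=1..m. of_nat (i * e i) * ?E i) $ j = (\<Sum>i=1..m. if 0 < j \<and> i dvd j then int (i * e i) else 0)"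
      by (auto simp: fps_sum_nth fps_of_nat[symmetric] fps_mult_left_const_nth
          simp del: of_nat_mult fps_of_nat intro!: sum.cong)
    also have "\<dots> = (if j = 0 then 0 else int (divisor_weight e j))"
    proof (cases "j = 0")
      case False
      then have "(\<Sum>i=1..m. if 0 < j \<and> i dvd j then int (i * e i) else 0) = (\<Sum>i | i \<in> {1..m} \<and> i dvd j. int (i * e i))"
        by (subst sum.inter_filter) auto
      also have "\<dots> = (\<Sum>i | i dvd j. int (i * e i))"
        using False supp' by (intro sum.mono_neutral_left) (auto simp: Suc_le_eq intro!: Nat.gr0I)
      finally show ?thesis using False by (simp add: divisor_weight_def)
    qed simp
    finally show "(\<Sum>i=1..m. of_nat (i * e i) * ?E i) $ j = Abs_fps (\<lambda>j. if j = 0 then 0 else int (divisor_weight e j)) $ j"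
      by simp
  qed
  ultimately show ?thesis unfolding F_def by simp
qed

text \<open>
  Since only the coefficients of \<open>1\<close> and \<open>t\<close> in \<open>P\<close> survive below \<open>t ^ N\<close>, the logarithmic
  derivative becomes a recursion for its own coefficients, in which each is \<open>a\<close> times the one before.
\<close>

lemma divisor_weight_eq_power:
  fixes e :: "nat \<Rightarrow> nat" and a N :: nat
  assumes supp: "\<And>i. i > m \<Longrightarrow> e i = 0"
  defines "P \<equiv> (\<Prod>i=1..m. (1 - monom 1 i) ^ e i :: int poly)"
  assumes "coeff P 0 = 1" and "coeff P 1 = - int a"
    and "\<And>j. 2 \<le> j \<Longrightarrow> j < N \<Longrightarrow> coeff P j = 0"
    and "1 \<le> j" and "j < N"
  shows "divisor_weight e j = a ^ j"
proof -
  have F: "fps_of_poly P = (\<Prod>i=1..m. (1 - fps_X ^ i) ^ e i)"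
    by (simp add: P_def fps_of_poly_prod fps_of_poly_power fps_of_poly_diff fps_of_poly_monom)
  define G where "G = Abs_fps (\<lambda>j. if j = 0 then 0 else int (divisor_weight e j))"
  have E: "fps_X * fps_deriv (fps_of_poly P) = - (fps_of_poly P * G)"
    unfolding F G_def by (rule log_derivative_prod) (fact supp)
  have rec: "int j * coeff P j = - (\<Sum>l=0..j. coeff P l * G $ (j - l))" if "0 < j" for j
  proof -
    have "(fps_X * fps_deriv (fps_of_poly P)) $ j = (- (fps_of_poly P * G)) $ j"
      by (simp only: E)
    then show ?thesis using that by (simp add: fps_mult_nth[of "fps_of_poly P"])
  qed
  from \<open>1 \<le> j\<close> \<open>j < N\<close> show ?thesis
  proof (induction j rule: nat_induct_at_least)
    case base
    show ?case using rec[of 1] assms by (simp add: G_def)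
  next
    case (Suc j)
    have "(\<Sum>l=0..Suc j. coeff P l * G $ (Suc j - l)) = (\<Sum>l\<in>{0,1}. coeff P l * G $ (Suc j - l))"
      using Suc assms by (intro sum.mono_neutral_right) auto
    then have "0 = - (int (divisor_weight e (Suc j)) - int a * int (divisor_weight e j))"
      using rec[of "Suc j"] Suc.hyps Suc.prems assms(3-5) by (simp add: G_def)
    then have "int (divisor_weight e (Suc j)) = int (a * a ^ j)"
      using Suc.IH Suc.prems by simp
    then show ?case by (simp only: of_nat_eq_iff power_Suc)
  qed
qed

section \<open>Exponent sum against degree\<close>

text \<open>
  Each factor is charged \<open>L \<le> i + (L - i)\<close>; the truncated difference vanishes for \<open>i \<ge> L\<close>, so
  only the small indices cost more than their share of the degree.
\<close>

lemma exponent_sum_le: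
  fixes e :: "nat \<Rightarrow> nat"
  assumes "\<And>i. i > m \<Longrightarrow> e i = 0"
  shows "L * (\<Sum>i=1..m. e i) \<le> (\<Sum>i=1..m. i * e i) + (\<Sum>i=1..<L. (L - i) * e i)"
proof -
  have "L * (\<Sum>i=1..m. e i) \<le> (\<Sum>i=1..m. i * e i + (L - i) * e i)"
    unfolding sum_distrib_left
    by (intro sum_mono) (metis add_mult_distrib le_add_diff_inverse le_add2 linear mult_le_mono1 diff_is_0_eq add.right_neutral)
  also have "\<dots> = (\<Sum>i=1..m. i * e i) + (\<Sum>i=1..m. (L - i) * e i)"
    by (simp add: sum.distrib)
  also have "(\<Sum>i=1..m. (L - i) * e i) = (\<Sum>i\<in>{1..m} \<inter> {1..<L}. (L - i) * e i)"
    by (intro sum.mono_neutral_right) auto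
  also have "\<dots> \<le> (\<Sum>i=1..<L. (L - i) * e i)"
    by (intro sum_mono2) auto
  finally show ?thesis by simp
qed

lemma divisor_weight_le_total:
  assumes "\<And>i. i > m \<Longrightarrow> e i = 0" and "j > 0"
  shows "divisor_weight e j \<le> (\<Sum>i=1..m. i * e i)"
proof -
  have supp': "i \<le> m" if "e i > 0" for i
    using assms(1)[of i] that by (cases "m < i") auto
  have "divisor_weight e j = (\<Sum>d\<in>{d. d dvd j} \<inter> {1..m}. d * e d)"
    unfolding divisor_weight_def using assms
    by (intro sum.mono_neutral_right) (auto simp: Suc_le_eq supp' intro!: Nat.gr0I)
  also have "\<dots> \<le> (\<Sum>i=1..m. i * e i)"
    by (intro sum_mono2) auto
  finally show ?thesis .
qed

lemma le_divisor_weight: "j > 0 \<Longrightarrow> j * e j \<le> divisor_weight e j"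
  unfolding divisor_weight_def by (rule member_le_sum[of j]) auto

lemma divisor_weight_prime: "prime j \<Longrightarrow> divisor_weight e j = e 1 + j * e j"
proof -
  assume "prime (j::nat)"
  then have "{d. d dvd j} = {1, j}" "j \<noteq> 1" by (auto simp: prime_nat_iff)
  then show ?thesis by (simp add: divisor_weight_def)
qed

text \<open>
  The sum is of order \<open>1 / L\<close>. A bound \<open>c / L\<close> passes from \<open>L\<close> to \<open>L + 1\<close> as soon as
  \<open>c \<ge> (L + 1) / (L - 1)\<close>, and at \<open>L = 6\<close> the sum equals \<open>8 / 30\<close>, which fixes \<open>c = 8 / 5\<close>.
\<close>

lemma sum_half_powers_div_le:
  "6 \<le> L \<Longrightarrow> (\<Sum>i=1..<L. (1/2::real) ^ (L - i) / real i) \<le> 8 / (5 * real L)"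
proof (induction L rule: nat_induct_at_least)
  case base
  show ?case by (simp add: eval_nat_numeral atLeastLessThanSuc)
next
  case (Suc L)
  have "(\<Sum>i=1..<Suc L. (1/2::real) ^ (Suc L - i) / real i) = (\<Sum>i=1..<L. (1/2) * ((1/2::real) ^ (L - i) / real i)) + 1/2/real L"
    using Suc.hyps by (simp add: Suc_diff_le)
  also have "\<dots> = (1/2) * (\<Sum>i=1..<L. (1/2::real) ^ (L - i) / real i) + 1/2/real L"
    by (simp add: sum_distrib_left)
  also have "\<dots> \<le> (1/2) * (8 / (5 * real L)) + 1/2/real L"
    using Suc.IH by simp
  also have "\<dots> \<le> 8 / (5 * real (Suc L))"
    using Suc.hyps by (simp add: field_simps)
  finally show ?case .
qed

lemma sum_half_powers_ge:
  "6 \<le> L \<Longrightarrow> 31/32 \<le> (\<Sum>i=1..<L. (1/2::real) ^ (L - i))"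
proof (induction L rule: nat_induct_at_least)
  case base
  show ?case by (simp add: eval_nat_numeral atLeastLessThanSuc)
next
  case (Suc L)
  have "(\<Sum>i=1..<Suc L. (1/2::real) ^ (Suc L - i)) = (\<Sum>i=1..<L. (1/2) * (1/2::real) ^ (L - i)) + 1/2"
    using Suc.hyps by (simp add: Suc_diff_le)
  also have "\<dots> = (1/2) * (\<Sum>i=1..<L. (1/2::real) ^ (L - i)) + 1/2"
    by (simp add: sum_distrib_left)
  finally show ?case using Suc.IH by simp
qed

text \<open>
  From \<open>i * e i \<le> a ^ i \<le> a ^ L / 2 ^ (L - i)\<close> each summand is at most
  \<open>a ^ L * (L / i - 1) / 2 ^ (L - i)\<close>, so the constant is \<open>8 / 5 - 31 / 32 = 101 / 160\<close>. There is
  little room: excluding \<open>N = 7\<close> for large \<open>k\<close> requires a constant of at most \<open>7 / 11\<close>.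
\<close>

lemma weighted_exponent_sum_le:
  fixes e :: "nat \<Rightarrow> nat" and a L :: nat
  assumes "\<And>i. 1 \<le> i \<Longrightarrow> i < L \<Longrightarrow> i * e i \<le> a ^ i" and "a \<ge> 2" and "L \<ge> 6"
  shows "real (\<Sum>i=1..<L. (L - i) * e i) \<le> 101/160 * real a ^ L"
proof -
  have "real ((L - i) * e i) \<le> real a ^ L * (real L * ((1/2) ^ (L - i) / real i) - (1/2) ^ (L - i))"
    if i: "i \<in> {1..<L}" for i
  proof -
    have "real (i * e i) \<le> real (a ^ i)"
      using assms(1)[of i] i by (intro of_nat_mono) auto
    also have "\<dots> \<le> real a ^ L * (1/2) ^ (L - i)"
    proof -
      have "real a ^ i * 2 ^ (L - i) \<le> real a ^ i * real a ^ (L - i)"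
        using assms(2) by (intro mult_left_mono power_mono) auto
      also have "\<dots> = real a ^ L" using i by (simp flip: power_add)
      finally show ?thesis by (simp add: power_one_over field_simps)
    qed
    finally have "real i * real (e i) \<le> real a ^ L * (1/2) ^ (L - i)" by simp
    then have "real (e i) \<le> real a ^ L * (1/2) ^ (L - i) / real i"
      using i by (simp add: field_simps)
    then have "real (L - i) * real (e i) \<le> real (L - i) * (real a ^ L * (1/2) ^ (L - i) / real i)"
      by (intro mult_left_mono) auto
    also have "\<dots> = real a ^ L * (real L * ((1/2) ^ (L - i) / real i) - (1/2) ^ (L - i))"
      using i by (simp add: of_nat_diff field_simps)
    finally show ?thesis by simp
  qed
  then have "real (\<Sum>i=1..<L. (L - i) * e i) \<le>
      (\<Sum>i=1..<L. real a ^ L * (real L * ((1/2) ^ (L - i) / real i) - (1/2) ^ (L - i)))"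
    unfolding of_nat_sum by (rule sum_mono)
  also have "\<dots> = real a ^ L * (real L * (\<Sum>i=1..<L. (1/2) ^ (L - i) / real i) - (\<Sum>i=1..<L. (1/2) ^ (L - i)))"
    by (simp only: sum_distrib_left[symmetric] sum_subtractf)
  also have "\<dots> \<le> real a ^ L * (8/5 - 31/32)"
  proof (intro mult_left_mono diff_mono)
    have "real L * (\<Sum>i=1..<L. (1/2) ^ (L - i) / real i) \<le> real L * (8 / (5 * real L))"
      by (intro mult_left_mono sum_half_powers_div_le assms) auto
    then show "real L * (\<Sum>i=1..<L. (1/2) ^ (L - i) / real i) \<le> 8/5"
      using assms(3) by simp
  qed (use sum_half_powers_ge assms in auto)
  finally show ?thesis by simp
qed

text \<open>
  The purely numerical core: the divisor sums and the total weight force the triple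
  \<open>(N, k, a)\<close>. For \<open>a = 1\<close> only \<open>e 1\<close> is nonzero below \<open>N\<close>. For \<open>N = 3\<close> the
  exceptional triple occurs; for \<open>N = 5\<close> the bound \<open>i * e i \<le> a ^ i\<close> is too weak at \<open>a = 2\<close>, and
  the exact values of \<open>e 2\<close> and \<open>e 3\<close> are used.
\<close>

lemma large_exponent_sum_imp:
  fixes e :: "nat \<Rightarrow> nat" and a k m N :: nat
  assumes supp: "\<And>i. i > m \<Longrightarrow> e i = 0"
    and weight: "\<And>j. 1 \<le> j \<Longrightarrow> j < N \<Longrightarrow> divisor_weight e j = a ^ j"
    and total: "(\<Sum>i=1..m. i * e i) = k * N + 1"
    and "odd N" and "N \<ge> 3" and "a \<ge> 1" and "k \<ge> 1"
    and large: "real (\<Sum>i=1..m. e i) > 21 / 11 * real k + 1"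
  shows "N = 3 \<and> k = 1 \<and> a = 2"
proof -
  define M where "M = (\<Sum>i=1..m. e i)"
  have e_le: "i * e i \<le> a ^ i" if "1 \<le> i" "i < N" for i
    using le_divisor_weight[of i e] weight[of i] that by simp
  have e1: "e 1 = a"
    using weight[of 1] \<open>N \<ge> 3\<close> by (simp add: divisor_weight_def)
  have bound: "(N - 1) * M \<le> k * N + 1 + (\<Sum>i=1..<N - 1. (N - 1 - i) * e i)"
    using exponent_sum_le[of m e "N - 1", OF supp] by (simp only: M_def total)
  have pow: "a ^ (N - 1) \<le> k * N + 1"
    using divisor_weight_le_total[of m e "N - 1", OF supp] weight[of "N - 1"] \<open>N \<ge> 3\<close> total by simp
  have large': "11 * M > 21 * k + 11"
    using large unfolding M_def[symmetric] by linarith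
  have "N \<noteq> 4" "N \<noteq> 6" using \<open>odd N\<close> by auto
  then consider "a = 1" | "a \<ge> 2" "N = 3" | "a \<ge> 2" "N = 5" | "a \<ge> 2" "N \<ge> 7"
    using \<open>a \<ge> 1\<close> \<open>N \<ge> 3\<close> by linarith
  then show ?thesis
  proof cases
    case 1
    have "(\<Sum>i=1..<N - 1. (N - 1 - i) * e i) = (\<Sum>i\<in>{1}. (N - 1 - i) * e i)"
    proof (intro sum.mono_neutral_right ballI)
      fix i assume i: "i \<in> {1..<N - 1} - {1}"
      then have "i * e i \<le> 1" "i \<ge> 2" using e_le[of i] 1 by auto
      then have "e i = 0" by (cases "e i") auto
      then show "(N - 1 - i) * e i = 0" by simp
    qed (use \<open>N \<ge> 3\<close> in auto)
    with bound e1 1 have b: "(N - 1) * M \<le> k * N + 1 + (N - 2)" by simp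
    obtain s where s: "N = s + 3" using \<open>N \<ge> 3\<close> by (metis add.commute le_Suc_ex)
    have "(s + 2) * (21 * k + 12) \<le> (s + 2) * (11 * M)"
      using large' by (intro mult_left_mono) auto
    with b have "(s + 2) * (21 * k + 12) \<le> 11 * (k * (s + 3) + 1 + (s + 1))"
      by (simp add: s)
    then have "10 * (s * k) + s + 9 * k + 2 \<le> 0"
      by (simp add: algebra_simps)
    then show ?thesis by simp
  next
    case 2
    have b: "2 * M \<le> 3 * k + 1 + a"
      using bound e1 2 by (simp add: eval_nat_numeral atLeastLessThanSuc)
    have p: "a ^ 2 \<le> 3 * k + 1" using pow 2 by simp
    have "9 * k + 13 \<le> 11 * a" using b large' by linarith
    then have "(9 * k + 13) ^ 2 \<le> (11 * a) ^ 2" by (intro power_mono) auto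
    also have "\<dots> \<le> 121 * (3 * k + 1)" using p by (simp add: power_mult_distrib)
    finally have q: "(9 * k + 13) ^ 2 \<le> 121 * (3 * k + 1)" .
    obtain s where s: "k = s + 1" using \<open>k \<ge> 1\<close> by (metis add.commute le_Suc_ex)
    \<comment> \<open>The quadratic inequality for \<open>k\<close> factors as \<open>(k - 1) * (81 * k - 48) \<le> 0\<close>.\<close>
    from q have "81 * s\<^sup>2 + 33 * s \<le> 0"
      unfolding s by (simp add: power2_eq_square algebra_simps)
    then have k: "k = 1" using s by simp
    have "a < 3"
    proof (rule ccontr)
      assume "\<not> a < 3"
      then have "3 ^ 2 \<le> a ^ 2" by (intro power_mono) auto
      with p k show False by simp
    qed
    with k 2 show ?thesis by simp
  next
    case 3
    have e2: "2 * e 2 + a = a ^ 2"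
      using weight[of 2] divisor_weight_prime[of 2 e] e1 3 by simp
    have e3: "3 * e 3 + a = a ^ 3"
      using weight[of 3] divisor_weight_prime[of 3 e] e1 3 by simp
    have b: "4 * M \<le> 5 * k + 1 + (3 * a + 2 * e 2 + e 3)"
      using bound e1 3 by (simp add: eval_nat_numeral atLeastLessThanSuc)
    have p: "a ^ 4 \<le> 5 * k + 1" using pow 3 by simp
    \<comment> \<open>Eliminate \<open>M\<close>, then \<open>k \<ge> (a ^ 4 - 1) / 5\<close>; at \<open>a = 2\<close> the sides are \<open>1860\<close> and \<open>1650\<close>.\<close>
    have "87 * a ^ 4 + 468 \<le> 275 * a + 165 * a ^ 2 + 55 * a ^ 3"
      using b large' p e2 e3 by linarith
    moreover have "2 * a ^ 3 \<le> a ^ 4" "2 * a ^ 2 \<le> a ^ 3"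
      using 3 mult_right_mono[of 2 a "a ^ 3"] mult_right_mono[of 2 a "a ^ 2"]
      by (simp_all add: power2_eq_square power3_eq_cube power4_eq_xxxx mult.assoc)
    moreover have "4 * a \<le> a ^ 2 + 4"
    proof -
      obtain s where s: "a = s + 2" using 3 by (metis add.commute le_Suc_ex)
      show ?thesis unfolding s by (simp add: power2_eq_square)
    qed
    ultimately have False by linarith
    then show ?thesis ..
  next
    case 4
    let ?L = "N - 1"
    have "real (\<Sum>i=1..<?L. (?L - i) * e i) \<le> 101/160 * real a ^ ?L"
      using 4 e_le by (intro weighted_exponent_sum_le) auto
    moreover have "real a ^ ?L \<le> real (k * N + 1)"
      using pow by (metis of_nat_le_iff of_nat_power)
    moreover have "real (?L * M) \<le> real (k * N + 1) + real (\<Sum>i=1..<?L. (?L - i) * e i)"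
      using bound by (metis of_nat_add of_nat_le_iff)
    moreover have "160 * x \<le> 261 * d" if "s \<le> 101/160 * w" "w \<le> d" "x \<le> d + s" for x d s w :: real
      using that by linarith
    ultimately have b: "160 * real (?L * M) \<le> 261 * real (k * N + 1)"
      by blast
    obtain s where s: "N = s + 7" using 4 by (metis add.commute le_Suc_ex)
    have "160 * ((s + 6) * (21 * k + 12)) \<le> 160 * ((s + 6) * (11 * M))"
      using large' by (intro mult_left_mono) auto
    also have "\<dots> \<le> 11 * (261 * (k * (s + 7) + 1))"
    proof -
      have "real (160 * ((s + 6) * M)) \<le> real (261 * (k * (s + 7) + 1))"
        using b by (simp add: s add.commute)
      then have "160 * ((s + 6) * M) \<le> 261 * (k * (s + 7) + 1)"
        by (simp only: of_nat_le_iff)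
      then show ?thesis by (simp add: algebra_simps)
    qed
    finally have False by (simp add: algebra_simps)
    then show ?thesis ..
  qed
qed

section \<open>Coefficients of the antisymmetrisation\<close>

lemma coeff_laurent_reverse:
  assumes "degree q \<le> d"
  shows "coeff (laurent_reverse d q) j = (if j \<le> d then coeff q (d - j) else 0)"
proof -
  have "coeff (laurent_reverse d q) j = (\<Sum>i\<le>degree q. if d - i = j then coeff q i else 0)"
    by (simp add: laurent_reverse_def coeff_sum)
  also have "\<dots> = (\<Sum>i\<le>degree q. if j \<le> d \<and> i = d - j then coeff q i else 0)"
    using assms by (intro sum.cong) auto
  also have "\<dots> = (if j \<le> d then coeff q (d - j) else 0)"
    by (auto simp: coeff_eq_0)
  finally show ?thesis .
qed

lemma coeff_sum_monom_mult:
  fixes \<alpha> :: "nat \<Rightarrow> 'a::comm_monoid_add"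
  assumes "N > 0"
  shows "coeff (\<Sum>i=0..k. monom (\<alpha> i) (i * N)) j = (if N dvd j \<and> j \<le> k * N then \<alpha> (j div N) else 0)"
proof -
  have "coeff (\<Sum>i=0..k. monom (\<alpha> i) (i * N)) j = (\<Sum>i=0..k. if i = j div N \<and> N dvd j then \<alpha> i else 0)"
    unfolding coeff_sum coeff_monom using assms by (intro sum.cong) auto
  also have "\<dots> = (if N dvd j \<and> j \<le> k * N then \<alpha> (j div N) else 0)"
  proof (cases "N dvd j")
    case True
    then obtain l where "j = l * N" by (metis dvd_def mult.commute)
    then show ?thesis using assms by simp
  qed simp
  finally show ?thesis .
qed

lemma degree_prod_one_minus_monom:
  "degree (\<Prod>i=1..m. (1 - monom 1 i) ^ e i :: 'a::idom poly) = (\<Sum>i=1..m. i * e i)"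
proof -
  have d: "degree (1 - monom 1 i :: 'a poly) = i" if "i \<ge> 1" for i
  proof -
    have "degree (1 - monom 1 i :: 'a poly) = degree (monom 1 i - 1 :: 'a poly)"
      by (metis degree_minus minus_diff_eq)
    also have "\<dots> = i"
      using that by (subst diff_conv_add_uminus, subst degree_add_eq_left) (auto simp: degree_monom_eq)
    finally show ?thesis .
  qed
  have "degree (\<Prod>i=1..m. (1 - monom 1 i) ^ e i :: 'a poly) = (\<Sum>i=1..m. degree ((1 - monom 1 i) ^ e i :: 'a poly))"
  proof (rule degree_prod_sum_eq)
    show "(1 - monom 1 i) ^ e i \<noteq> (0 :: 'a poly)" if "i \<in> {1..m}" for i
      using d[of i] that by (auto simp: atLeastAtMost_iff)
  qed
  also have "\<dots> = (\<Sum>i=1..m. i * e i)"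
  proof (intro sum.cong refl)
    fix i assume "i \<in> {1..m}"
    then show "degree ((1 - monom 1 i) ^ e i :: 'a poly) = i * e i"
      using d[of i] by (subst degree_power_eq) auto
  qed
  finally show ?thesis .
qed

theorem theorem0p6:
  fixes N k m :: nat
    and \<alpha> :: "nat \<Rightarrow> int"
    and n :: "nat \<Rightarrow> nat"
    and p q :: "int poly"
  assumes "prime N" and "odd N"
    and "k > 0"
    and "\<alpha> 0 = 1"
    and "\<And>i. i \<le> k \<Longrightarrow> \<alpha> i > 0"
    and "q = (\<Sum>i=0..k. monom (\<alpha> i) (i * N))"
    and "p = q - laurent_reverse (k * N + 1) q"
    and "m > 0"
    and "n m > 0"
    and "p = (\<Prod>i=1..m. (1 - monom 1 i) ^ n i)"
    and "real (\<Sum>i=1..m. n i) > 21 / 11 * real k + 1"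
  shows "N = 3 \<and> k = 1
    \<and> p = (1 - monom 1 1) ^ 2 * (1 - monom 1 2)
    \<and> q = 1 + monom 2 3"
proof -
  have "N \<ge> 3"
    using \<open>prime N\<close> \<open>odd N\<close> prime_ge_2_nat[of N] by (cases "N = 2") auto
  define a where "a = nat (\<alpha> k)"
  have a: "\<alpha> k = int a" "a \<ge> 1" using assms(5)[of k] by (auto simp: a_def)
  have q: "coeff q j = (if N dvd j \<and> j \<le> k * N then \<alpha> (j div N) else 0)" for j
    unfolding assms(6) using \<open>N \<ge> 3\<close> by (intro coeff_sum_monom_mult) auto
  have "degree q \<le> k * N" by (rule degree_le) (simp add: q)
  then have p: "coeff p j = coeff q j - (if j \<le> k * N + 1 then coeff q (k * N + 1 - j) else 0)" for j
    unfolding assms(7) by (simp add: coeff_laurent_reverse)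
  have ndvd: "\<not> N dvd j" if "0 < j" "j < N" for j
    using that by (auto dest: dvd_imp_le)
  have ndvd': "\<not> N dvd k * N + 1"
    using \<open>N \<ge> 3\<close> by (subst dvd_add_right_iff) auto
  have p0: "coeff p 0 = 1"
    using ndvd' assms(4) by (simp add: p q)
  have p1: "coeff p 1 = - int a"
    using \<open>N \<ge> 3\<close> a ndvd[of 1] by (simp add: p q)
  have pj: "coeff p j = 0" if "2 \<le> j" "j < N" for j
  proof -
    have "\<not> N dvd k * N + 1 - j" if "j \<le> k * N + 1"
    proof
      assume "N dvd k * N + 1 - j"
      then have "N dvd k * N - (k * N + 1 - j)"
        using dvd_diff_nat[of N "k * N" "k * N + 1 - j"] by simp
      moreover have "k * N - (k * N + 1 - j) = j - 1"
        using that \<open>2 \<le> j\<close> by simp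
      ultimately have "N dvd j - 1" by simp
      then show False using ndvd[of "j - 1"] \<open>2 \<le> j\<close> \<open>j < N\<close> by linarith
    qed
    then show ?thesis using ndvd[of j] that by (simp add: p q)
  qed
  have "degree p = k * N + 1"
  proof (rule antisym)
    show "degree p \<le> k * N + 1" by (rule degree_le) (simp add: p q)
    have "coeff p (k * N + 1) = -1" using ndvd' assms(4) by (simp add: p q)
    then show "k * N + 1 \<le> degree p" by (intro le_degree) simp
  qed
  \<comment> \<open>Values of \<open>n\<close> beyond \<open>m\<close> are arbitrary, but divisor sums may run over such indices.\<close>
  define e where "e i = (if i \<le> m then n i else 0)" for i
  have supp: "e i = 0" if "i > m" for i using that by (simp add: e_def)
  have pe: "p = (\<Prod>i=1..m. (1 - monom 1 i) ^ e i)"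
    unfolding assms(10) by (intro prod.cong) (auto simp: e_def)
  have total: "(\<Sum>i=1..m. i * e i) = k * N + 1"
    using \<open>degree p = k * N + 1\<close> unfolding pe degree_prod_one_minus_monom .
  have weight: "divisor_weight e j = a ^ j" if "1 \<le> j" "j < N" for j
    using divisor_weight_eq_power[of m e a N j] supp p0 p1 pj that unfolding pe by blast
  have "(\<Sum>i=1..m. e i) = (\<Sum>i=1..m. n i)"
    by (intro sum.cong) (auto simp: e_def)
  then have large: "real (\<Sum>i=1..m. e i) > 21 / 11 * real k + 1"
    using assms(11) by simp
  have main: "N = 3" "k = 1" "a = 2"
    using large_exponent_sum_imp[OF supp weight total \<open>odd N\<close> \<open>N \<ge> 3\<close> \<open>a \<ge> 1\<close> _ large] \<open>k > 0\<close> by auto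
  have q_eq: "q = 1 + monom 2 3"
    using assms(4,6) a main by (simp add: monom_0 one_pCons)
  have p_eq: "p = (1 - monom 1 1) ^ 2 * (1 - monom 1 2)"
  proof -
    have "p = monom 1 0 - monom 2 1 + monom 2 3 - monom 1 4"
    proof (rule poly_eqI)
      fix j :: nat
      consider "j = 0" | "j = 1" | "j = 2" | "j = 3" | "j = 4" | "j > 4" by linarith
      then show "coeff p j = coeff (monom 1 0 - monom 2 1 + monom 2 3 - monom 1 4) j"
        by cases (simp_all add: p q_eq main coeff_1)
    qed
    also have "\<dots> = (1 - monom 1 1) ^ 2 * (1 - monom 1 2)"
    proof -
      define x :: "int poly" where "x = monom 1 1"
      have x: "monom 1 i = x ^ i" for i by (simp add: x_def monom_power)
      have x2: "monom 2 i = 2 * x ^ i" for i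
        unfolding x[symmetric] by (simp add: mult_2 add_monom)
      show ?thesis unfolding x x2 by algebra
    qed
    finally show ?thesis .
  qed
  show ?thesis using main q_eq p_eq by blast
qed

end
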